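(* Let $X$ be an alphabet with $|X|=2$. Let $V$ be a finite set of finite words over $X$ (a system of prohibitions) which defines the two-sided infinite word $W=u^\infty$, where $u$ is a nonempty finite non-periodic word. Then $|u|\le F(|V|)$.
   Context: Words are finite or infinite sequences of letters of $X$; $|u|$ is the length of a finite word $u$; $\Lambda$ is the empty word. A word $v$ is a subword of $w$ if $w=v_1vv_2$ for some words $v_1,v_2$. A nonempty finite word $u$ is periodic if $u=v^m$ for some word $v$ and some $m\ge 2$, and non-periodic otherwise. For a finite word $u$, $u^\infty=\dots uuu\dots$ is the two-sided infinite word with period $u$ (two-sided infinite words are considered up to shift). A (finite or infinite) word $w$ satisfies a finite set of words $V$ if no $v\in V$ is a subword of $w$; $V$ defines the two-sided infinite word $W$ if $W$ is the unique two-sided infinite word satisfying $V$. The Fibonacci numbers are defined by $F(0)=F(1)=1$ and $F(m+1)=F(m)+F(m-1)$. *)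

theory Defs
  imports "HOL-Number_Theory.Fib"
begin

text \<open>
  Finite words are lists. A two-sided infinite word is represented by a function
  \<open>int \<Rightarrow> 'a\<close>; two such functions represent the same word iff they differ by a shift.
\<close>

type_synonym 'a biword = "int \<Rightarrow> 'a"

definition shift_equiv :: "'a biword \<Rightarrow> 'a biword \<Rightarrow> bool" where
  "shift_equiv w w' \<longleftrightarrow> (\<exists>k. \<forall>i. w' i = w (i + k))"

definition factor :: "'a list \<Rightarrow> 'a biword \<Rightarrow> bool" where
  "factor v w \<longleftrightarrow> (\<exists>i. \<forall>j < length v. v ! j = w (i + int j))"

definition satisfies :: "'a biword \<Rightarrow> 'a list set \<Rightarrow> bool" where
  "satisfies w V \<longleftrightarrow> (\<forall>v \<in> V. \<not> factor v w)"

text \<open>Existence and uniqueness up to shift, among the two-sided words over \<open>X\<close>.\<close>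

definition defines_word :: "'a set \<Rightarrow> 'a list set \<Rightarrow> 'a biword \<Rightarrow> bool" where
  "defines_word X V W \<longleftrightarrow> range W \<subseteq> X \<and> satisfies W V \<and>
     (\<forall>W'. range W' \<subseteq> X \<longrightarrow> satisfies W' V \<longrightarrow> shift_equiv W W')"

definition periodic :: "'a list \<Rightarrow> bool" where
  "periodic u \<longleftrightarrow> u \<noteq> [] \<and> (\<exists>v m. 2 \<le> m \<and> u = concat (replicate m v))"

text \<open>\<open>u\<^sup>\<infinity>\<close>; meaningful only for \<open>u \<noteq> []\<close>.\<close>

definition biinf_power :: "'a list \<Rightarrow> 'a biword" where
  "biinf_power u = (\<lambda>i. u ! nat (i mod int (length u)))"

text \<open>The library's \<open>fib\<close> starts with \<open>fib 0 = 0\<close>; here the sequence starts with 1, 1.\<close>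

definition F :: "nat \<Rightarrow> nat" where
  "F m = fib (Suc m)"

lemma F_0: "F 0 = 1"
  and F_1: "F 1 = 1"
  and F_rec: "1 \<le> m \<Longrightarrow> F (m + 1) = F m + F (m - 1)"
  by (cases m; simp add: F_def)+

end

theory Submission
  imports Defs "HOL-Library.Sublist"
begin

text \<open>
  Let \<open>W\<close> have exact period \<open>n\<close>. Gluing a left and a right ray of \<open>W\<close> along a minimal forbidden
  word \<open>z\<close> gives a word whose forbidden factors all contain \<open>z\<close>; hence any set defining \<open>W\<close>
  has at least as many elements as there are minimal forbidden words of \<open>W\<close>, and it suffices to
  bound \<open>n\<close> by \<open>F k\<close>, where \<open>k\<close> is the number of the latter.

  Let \<open>w\<close> be a longest word with two occurrences that are incongruent modulo \<open>n\<close>. The two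
  returns to \<open>w\<close> split the period as \<open>n = x + y\<close> with \<open>x \<le> y\<close>. If \<open>c w d'\<close> and \<open>c' w d\<close> are the
  extensions of \<open>w\<close> in \<open>W\<close>, then \<open>c w d\<close> and \<open>c' w d'\<close> are minimal forbidden words; dropping
  both and forbidding one word in their place defines either of the two loops, so both loops have
  at most \<open>k - 1\<close> minimal forbidden words. For the loop of length \<open>x\<close> the additional word can be
  chosen inside one of the remaining \<open>k - 2\<close> ones, which it then replaces. By induction
  \<open>n \<le> F (k - 1) + F (k - 2)\<close>.
\<close>

section \<open>Windows and factors of two-sided words\<close>

definition window :: "'a biword \<Rightarrow> int \<Rightarrow> nat \<Rightarrow> 'a list" where
  "window f i l = map (\<lambda>j. f (i + int j)) [0..<l]"

lemma length_window [simp]: "length (window f i l) = l"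
  by (simp add: window_def)

lemma nth_window [simp]: "j < l \<Longrightarrow> window f i l ! j = f (i + int j)"
  by (simp add: window_def)

lemma window_eq_iff: "window f i l = window g j l \<longleftrightarrow> (\<forall>t<l. f (i + int t) = g (j + int t))"
  by (auto simp: list_eq_iff_nth_eq)

lemma window_eqD: "window f i l = window g j l \<Longrightarrow> t < l \<Longrightarrow> f (i + int t) = g (j + int t)"
  by (simp add: window_eq_iff)

lemma window_0 [simp]: "window f i 0 = []"
  by (simp add: window_def)

lemma window_add: "window f i (a + b) = window f i a @ window f (i + int a) b"
  by (auto simp: list_eq_iff_nth_eq nth_append algebra_simps of_nat_diff)

lemma window_Suc: "window f i (Suc l) = f i # window f (i + 1) l"
  using window_add[of f i 1 l] by (simp add: window_def)

lemma window_Suc': "window f i (Suc l) = window f i l @ [f (i + int l)]"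
  by (simp add: window_def)

lemma tl_window [simp]: "tl (window f i (Suc l)) = window f (i + 1) l"
  by (simp add: window_Suc)

lemma butlast_window [simp]: "butlast (window f i (Suc l)) = window f i l"
  by (simp add: window_Suc')

lemma factor_iff_window: "factor v f \<longleftrightarrow> (\<exists>i. v = window f i (length v))"
  by (auto simp: factor_def list_eq_iff_nth_eq)

lemma factor_window [simp]: "factor (window f i l) f"
  by (auto simp: factor_iff_window)

lemma factor_Nil [simp]: "factor [] f"
  by (simp add: factor_def)

lemma sublist_window:
  assumes "i \<le> j" "j + int l' \<le> i + int l"
  shows "sublist (window f j l') (window f i l)"
proof -
  define a where "a = nat (j - i)"
  define b where "b = l - a - l'"
  have l: "l = a + (l' + b)" and j: "j = i + int a"
    using assms by (auto simp: a_def b_def)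
  show ?thesis
    unfolding l j window_add sublist_def by blast
qed

lemma factor_sublist: "factor v f \<Longrightarrow> sublist z v \<Longrightarrow> factor z f"
proof -
  assume "factor v f" "sublist z v"
  then obtain i ps ss where i: "v = window f i (length v)" and v: "v = ps @ z @ ss"
    by (auto simp: factor_iff_window sublist_def)
  have "ps @ z @ ss = window f i (length ps + (length z + length ss))"
    using i v by simp
  then have "z = window f (i + int (length ps)) (length z)"
    unfolding window_add by (simp add: append_eq_append_conv)
  then show ?thesis
    by (auto simp: factor_iff_window)
qed

lemma factor_shift: "factor v (\<lambda>i. f (i + k)) \<longleftrightarrow> factor v f"
proof -
  have *: "window (\<lambda>i. f (i + k)) i l = window f (i + k) l" for i l
    by (simp add: window_def algebra_simps)
  show ?thesis
    unfolding factor_iff_window * by (metis diff_add_cancel)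
qed

lemma shift_equiv_factor: "shift_equiv f g \<Longrightarrow> factor v g \<longleftrightarrow> factor v f"
proof -
  assume "shift_equiv f g"
  then obtain k where "g = (\<lambda>i. f (i + k))"
    by (auto simp: shift_equiv_def)
  then show ?thesis
    by (simp add: factor_shift)
qed

section \<open>Minimal forbidden words and defining sets\<close>

text \<open>Every proper sublist of \<open>z\<close> lies in \<open>tl z\<close> or in
  \<open>butlast z\<close>, so these two suffice to express minimality.\<close>

definition mfw :: "'a set \<Rightarrow> 'a biword \<Rightarrow> 'a list set" where
  "mfw X W = {z \<in> lists X. z \<noteq> [] \<and> \<not> factor z W \<and> factor (tl z) W \<and> factor (butlast z) W}"

lemma mfw_shift: "mfw X (\<lambda>i. W (i + k)) = mfw X W"
  by (simp add: mfw_def factor_shift)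

lemma mfw_iff:
  "a # g @ [b] \<in> mfw X W \<longleftrightarrow> a \<in> X \<and> b \<in> X \<and> g \<in> lists X \<and> \<not> factor (a # g @ [b]) W
     \<and> factor (g @ [b]) W \<and> factor (a # g) W"
proof -
  have "butlast (a # g @ [b]) = a # g"
    by (metis butlast_snoc append_Cons)
  then show ?thesis
    by (auto simp: mfw_def)
qed

lemma mfw_window:
  "window W' s (Suc l) \<in> mfw X W \<longleftrightarrow> window W' s (Suc l) \<in> lists X \<and> \<not> factor (window W' s (Suc l)) W
     \<and> factor (window W' (s + 1) l) W \<and> factor (window W' s l) W"
  by (simp only: mfw_def tl_window butlast_window mem_Collect_eq) (simp add: window_Suc)

lemma range_window: "range W \<subseteq> X \<Longrightarrow> window W i l \<in> lists X"
  by (force simp: window_def)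

text \<open>A left ray of \<open>W\<close> ending in \<open>butlast z\<close> and a right ray
  starting with \<open>tl z\<close> overlap in the middle of \<open>z\<close>. A window that does
  not cover all of \<open>z\<close> misses its first or its last letter, so it lies in one of the
  rays and is a factor of \<open>W\<close>.\<close>

lemma splice:
  assumes "range W \<subseteq> X" "z \<in> mfw X W"
  obtains W' where "range W' \<subseteq> X" "factor z W'"
    "\<And>v. factor v W' \<Longrightarrow> \<not> factor v W \<Longrightarrow> sublist z v"
proof -
  define l where "l = length z"
  have l: "l > 0" and zX: "set z \<subseteq> X"
    using assms(2) by (auto simp: l_def mfw_def)
  obtain p where p: "\<forall>j<l-1. z ! j = W (p + int j)"
    using assms(2) by (auto simp: mfw_def factor_def l_def nth_butlast)
  obtain q where q: "\<forall>j<l-1. z ! Suc j = W (q + int j)"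
    using assms(2) by (auto simp: mfw_def factor_def l_def nth_tl)
  define W' where "W' i = (if i < 0 then W (p + i) else if i < int l then z ! nat i else W (q + i - 1))" for i
  have Wp: "W' i = W (p + i)" if "i < int l - 1" for i
  proof (cases "i < 0")
    case False
    then have "z ! nat i = W (p + int (nat i))"
      using p that by (auto simp: nat_less_iff)
    then show ?thesis
      using False that by (simp add: W'_def)
  qed (simp add: W'_def)
  have Wq: "W' i = W (q + i - 1)" if "i \<ge> 1" for i
  proof (cases "i < int l")
    case True
    then have "z ! Suc (nat (i - 1)) = W (q + int (nat (i - 1)))"
      using q that l by (auto simp: nat_less_iff)
    moreover have "Suc (nat (i - 1)) = nat i" "int (nat (i - 1)) = i - 1"
      using that by auto
    ultimately show ?thesis
      using True that by (simp add: W'_def algebra_simps)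
  qed (use that in \<open>simp add: W'_def\<close>)
  have z: "window W' 0 l = z"
    by (auto simp: list_eq_iff_nth_eq l_def W'_def)
  show thesis
  proof
    have "z ! nat i \<in> X" if "0 \<le> i" "i < int l" for i
      using zX that by (auto simp: l_def nat_less_iff intro!: nth_mem subsetD[OF zX])
    then show "range W' \<subseteq> X"
      using assms(1) by (auto simp: W'_def)
    show "factor z W'"
      using z factor_window by metis
    fix v assume v: "factor v W'" "\<not> factor v W"
    then obtain i where i: "v = window W' i (length v)"
      by (auto simp: factor_iff_window)
    have "\<not> i + int (length v) \<le> int l - 1"
    proof
      assume *: "i + int (length v) \<le> int l - 1"
      have "v = window W (p + i) (length v)"
        by (subst i) (use * in \<open>auto simp: window_eq_iff Wp algebra_simps\<close>)
      with v(2) show False by (metis factor_window)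
    qed
    moreover have "\<not> i \<ge> 1"
    proof
      assume *: "i \<ge> 1"
      have "v = window W (q + i - 1) (length v)"
        by (subst i) (use * in \<open>auto simp: window_eq_iff Wq algebra_simps\<close>)
      with v(2) show False by (metis factor_window)
    qed
    ultimately have "sublist (window W' 0 l) (window W' i (length v))"
      by (intro sublist_window) auto
    then show "sublist z v"
      using i z by simp
  qed
qed

text \<open>The splice at \<open>z\<close> is not \<open>W\<close>, so it contains some
  \<open>h z\<close> in \<open>V\<close>; as \<open>W\<close> avoids \<open>V\<close>, this
  \<open>h z\<close> contains \<open>z\<close>. If \<open>h z = h z'\<close>, then \<open>z'\<close>
  also occurs in the splice at \<open>z\<close> and hence contains \<open>z\<close>; by symmetry
  both are equal, so \<open>h\<close> is injective.\<close>

lemma card_mfw_le: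
  assumes "finite V" "defines_word X V W"
  shows "finite (mfw X W) \<and> card (mfw X W) \<le> card V"
proof -
  have rW: "range W \<subseteq> X" and sat: "satisfies W V"
    using assms(2) by (auto simp: defines_word_def)
  have "\<exists>v\<in>V. \<exists>W'. factor v W' \<and> (\<forall>v. factor v W' \<longrightarrow> \<not> factor v W \<longrightarrow> sublist z v)"
    if z: "z \<in> mfw X W" for z
  proof -
    obtain W' where W': "range W' \<subseteq> X" "factor z W'"
      "\<And>v. factor v W' \<Longrightarrow> \<not> factor v W \<Longrightarrow> sublist z v"
      using splice[OF rW z] by metis
    have "\<not> factor z W"
      using z by (simp add: mfw_def)
    then have "\<not> shift_equiv W W'"
      using W'(2) shift_equiv_factor by blast
    then have "\<not> satisfies W' V"
      using assms(2) W'(1) by (auto simp: defines_word_def)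
    then show ?thesis
      using W'(3) by (auto simp: satisfies_def)
  qed
  then obtain h W' where h: "\<And>z. z \<in> mfw X W \<Longrightarrow> h z \<in> V"
    "\<And>z. z \<in> mfw X W \<Longrightarrow> factor (h z) (W' z)"
    "\<And>z v. z \<in> mfw X W \<Longrightarrow> factor v (W' z) \<Longrightarrow> \<not> factor v W \<Longrightarrow> sublist z v"
    by metis
  have sub: "sublist z (h z)" if "z \<in> mfw X W" for z
    using h(3)[OF that h(2)[OF that]] h(1)[OF that] sat by (auto simp: satisfies_def)
  have *: "sublist z z'" if "z \<in> mfw X W" "z' \<in> mfw X W" "h z = h z'" for z z'
  proof -
    have "factor z' (W' z)"
      using factor_sublist[OF h(2)[OF that(1)]] sub[OF that(2)] that(3) by simp
    then show ?thesis
      using h(3)[OF that(1)] that(2) by (simp add: mfw_def)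
  qed
  have "inj_on h (mfw X W)"
    by (intro inj_onI) (metis * sublist_order.order_antisym)
  moreover have "h ` mfw X W \<subseteq> V"
    using h(1) by blast
  ultimately show ?thesis
    using assms(1) by (meson card_inj_on_le finite_subset inj_on_finite)
qed

section \<open>Auxiliary facts on windows and periods\<close>

lemma window_eq_sub:
  assumes "window f i l = window g j l" "k + l' \<le> l"
  shows "window f (i + int k) l' = window g (j + int k) l'"
  using window_eqD[OF assms(1), of "k + _"] assms(2) by (auto simp: window_eq_iff add.assoc)

lemma window_eq_prefix:
  "window f i l = window g j l \<Longrightarrow> l' \<le> l \<Longrightarrow> window f i l' = window g j l'"
  using window_eq_sub[of f i l g j 0 l'] by simp

lemma periodic_dvd:
  fixes f :: "'a biword"
  assumes "\<And>i. f (i + n) = f i" "n dvd p - q"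
  shows "f p = f q"
proof -
  have nat: "f (i + n * int k) = f i" for i k
  proof (induction k)
    case (Suc k)
    have "f (i + n * int (Suc k)) = f (i + n * int k + n)"
      by (simp add: algebra_simps)
    then show ?case using assms(1) Suc by simp
  qed simp
  obtain k where k: "p = q + n * k"
    using assms(2) by (auto simp: dvd_def algebra_simps)
  show ?thesis
  proof (cases "k \<ge> 0")
    case True
    then show ?thesis using nat[of q "nat k"] k by simp
  next
    case False
    then show ?thesis using nat[of p "nat (- k)"] k by simp
  qed
qed

lemma card_2_eq: "card X = 2 \<Longrightarrow> a \<in> X \<Longrightarrow> b \<in> X \<Longrightarrow> a \<noteq> b \<Longrightarrow> X = {a, b}"
  by (auto simp: card_2_iff)

section \<open>Two returns to a longest repeated word\<close>

text \<open>
  \<open>W\<close> has period \<open>x + y\<close>, and the word of length \<open>m\<close> at position 0 recurs at position \<open>x\<close>;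
  \<open>maximal\<close> makes the period exact as well.
\<close>

locale double_return =
  fixes X :: "'a set" and W :: "'a biword" and m :: nat and x y :: int
  assumes card_X: "card X = 2" and range_W: "range W \<subseteq> X"
    and period: "W (i + (x + y)) = W i"
    and x_pos: "0 < x" and y_pos: "0 < y"
    and return: "window W x m = window W 0 m"
    and maximal: "window W p (Suc m) = window W q (Suc m) \<Longrightarrow> x + y dvd p - q"
begin

abbreviation "w \<equiv> window W 0 m"

text \<open>The occurrences of \<open>w\<close> at 0 and \<open>x\<close> have the neighbours
  \<open>W (-1)\<close>, \<open>W (int m)\<close> and \<open>W (x - 1)\<close>,
  \<open>W (x + int m)\<close>; \<open>bad1\<close> and \<open>bad2\<close> exchange the right ones.
  Reading the return of length \<open>x\<close> twice in a row produces \<open>bad1\<close>,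
  repeating the other return produces \<open>bad2\<close>.\<close>

definition "bad1 = W (x - 1) # w @ [W (int m)]"

definition "bad2 = W (-1) # w @ [W (x + int m)]"

definition "core = mfw X W - {bad1, bad2}"

lemma W_in: "W i \<in> X"
  using range_W by auto

lemma W_cong: "x + y dvd p - q \<Longrightarrow> W p = W q"
  by (rule periodic_dvd[of W "x + y"]) (use period in auto)

lemma window_cong: "x + y dvd p - q \<Longrightarrow> window W p l = window W q l"
  by (auto simp: window_eq_iff intro!: W_cong)

lemma small_dvd: "x + y dvd d \<Longrightarrow> \<bar>d\<bar> < x + y \<Longrightarrow> d = 0"
  using dvd_imp_le_int[of d "x + y"] x_pos y_pos by auto

lemma not_dvd_x: "\<not> x + y dvd x" "\<not> x + y dvd - x"
  using small_dvd[of x] small_dvd[of "- x"] x_pos y_pos by auto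

lemma left_x: "window W (x - 1) (Suc m) = W (x - 1) # w"
  using return by (simp add: window_Suc)

lemma left_0: "window W (-1) (Suc m) = W (-1) # w"
  by (simp add: window_Suc)

lemma right_x: "window W x (Suc m) = w @ [W (x + int m)]"
  using return by (simp add: window_Suc')

lemma right_0: "window W 0 (Suc m) = w @ [W (int m)]"
  by (simp add: window_Suc')

lemma neq_left: "W (x - 1) \<noteq> W (-1)"
  using maximal[of "x - 1" "-1"] not_dvd_x left_x left_0 by auto

text \<open>Over two letters, the letter before \<open>w\<close> is \<open>W (x - 1)\<close> or
  \<open>W (-1)\<close>, and the resulting window of length \<open>m + 1\<close> fixes the position
  by \<open>maximal\<close>.\<close>

lemma occurrence_w:
  assumes "window W i m = w"
  shows "x + y dvd i \<or> x + y dvd i - x"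
proof -
  have "X = {W (x - 1), W (-1)}"
    by (rule card_2_eq) (use card_X W_in neq_left in auto)
  then have "W (i - 1) = W (x - 1) \<or> W (i - 1) = W (-1)"
    using W_in by blast
  moreover have "window W (i - 1) (Suc m) = W (i - 1) # w"
    using assms by (simp add: window_Suc)
  ultimately show ?thesis
    using maximal[of "i - 1" "x - 1"] maximal[of "i - 1" "-1"] left_x left_0 by auto
qed

text \<open>The prefix and the suffix of length \<open>m + 1\<close> each fix the position of an
  occurrence modulo \<open>x + y\<close>, and the two values differ by \<open>x\<close> up to
  sign.\<close>

lemma not_factor_bad: "\<not> factor bad1 W" "\<not> factor bad2 W"
proof -
  have *: "window W i (Suc m) = a # w \<and> window W (i + 1) (Suc m) = w @ [b]"
    if "a # w @ [b] = window W i (length (a # w @ [b]))" for a b i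
  proof -
    have "a # w @ [b] = window W i (Suc (Suc m))"
      using that by simp
    then have *: "a = W i" "w @ [b] = window W (i + 1) (Suc m)"
      by (simp_all add: window_Suc[of W i "Suc m"])
    then have "w = window W (i + 1) m"
      by (metis butlast_snoc butlast_window)
    with * show ?thesis
      by (simp add: window_Suc[of W i m])
  qed
  show "\<not> factor bad1 W"
  proof
    assume "factor bad1 W"
    then obtain i where "window W i (Suc m) = W (x - 1) # w" "window W (i + 1) (Suc m) = w @ [W (int m)]"
      using * unfolding factor_iff_window bad1_def by blast
    then have "x + y dvd i - (x - 1)" "x + y dvd i + 1 - 0"
      using maximal[of i "x - 1"] maximal[of "i + 1" 0] left_x right_0 by metis+
    then have "x + y dvd (i + 1 - 0) - (i - (x - 1))"
      using dvd_diff by blast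
    then show False using not_dvd_x by simp
  qed
  show "\<not> factor bad2 W"
  proof
    assume "factor bad2 W"
    then obtain i where "window W i (Suc m) = W (-1) # w" "window W (i + 1) (Suc m) = w @ [W (x + int m)]"
      using * unfolding factor_iff_window bad2_def by blast
    then have "x + y dvd i - (-1)" "x + y dvd i + 1 - x"
      using maximal[of i "-1"] maximal[of "i + 1" x] left_0 right_x by metis+
    then have "x + y dvd (i - (-1)) - (i + 1 - x)"
      using dvd_diff by blast
    then show False using not_dvd_x by simp
  qed
qed

lemma bad_in_mfw: "bad1 \<in> mfw X W" "bad2 \<in> mfw X W"
  using not_factor_bad W_in range_window[OF range_W, of 0 m]
  unfolding bad1_def bad2_def mfw_iff
  by (simp_all flip: left_x left_0 right_x right_0)

lemma bad_neq: "bad1 \<noteq> bad2"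
  using neq_left by (simp add: bad1_def bad2_def)

lemma length_bad: "length bad1 = Suc (Suc m)" "length bad2 = Suc (Suc m)"
  by (simp_all add: bad1_def bad2_def)

lemma card_core: "finite (mfw X W) \<Longrightarrow> Suc (Suc (card core)) = card (mfw X W)"
proof -
  assume fin: "finite (mfw X W)"
  have "mfw X W = insert bad1 (insert bad2 core)" "bad1 \<notin> insert bad2 core" "bad2 \<notin> core"
    using bad_in_mfw bad_neq by (auto simp: core_def)
  moreover have "finite core"
    using fin by (simp add: core_def)
  ultimately show ?thesis by simp
qed

text \<open>In a longer \<open>z\<close> the middle part has length at least \<open>m + 1\<close>,
  so the occurrences of \<open>butlast z\<close> and \<open>tl z\<close> are aligned modulo the
  period and \<open>z\<close> itself would occur in \<open>W\<close>.\<close>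

lemma length_mfw_le:
  assumes "z \<in> mfw X W"
  shows "length z \<le> Suc (Suc m)"
proof (rule ccontr)
  assume "\<not> ?thesis"
  then obtain l where l: "length z = Suc (Suc (Suc (m + l)))"
    by (metis add_Suc less_iff_Suc_add not_le)
  obtain p where p: "butlast z = window W p (Suc (Suc (m + l)))"
    using assms l by (auto simp: mfw_def factor_iff_window)
  obtain q where q: "tl z = window W q (Suc (Suc (m + l)))"
    using assms l by (auto simp: mfw_def factor_iff_window)
  have "tl (butlast z) = butlast (tl z)"
    by (simp add: butlast_tl)
  then have "window W (p + 1) (Suc (m + l)) = window W q (Suc (m + l))"
    by (simp add: p q)
  then have "window W (p + 1) (Suc m) = window W q (Suc m)"
    by (rule window_eq_prefix) simp
  then have "x + y dvd p + 1 - q"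
    by (rule maximal)
  then have "tl z = window W (p + 1) (Suc (Suc (m + l)))"
    using q window_cong by metis
  moreover have "z = hd z # tl z"
    using l by (cases z) auto
  moreover have "hd z = W p"
    using p l by (cases z) (auto simp: window_Suc split: if_splits)
  ultimately have "z = window W p (Suc (Suc (Suc (m + l))))"
    by (simp add: window_Suc[of W p "Suc (Suc (m + l))"])
  then show False
    using assms factor_window by (metis (no_types, lifting) mem_Collect_eq mfw_def)
qed

lemma mfw_short: "z \<in> mfw X W \<Longrightarrow> length z \<noteq> Suc (Suc m) \<Longrightarrow> z \<in> core"
  using length_bad by (auto simp: core_def)

text \<open>Moving the origin to the second occurrence of \<open>w\<close> swaps the two returns, so
  everything shown for the loop of length \<open>x\<close> also applies to the one of length
  \<open>y\<close>.\<close>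

lemma double_return_shift: "double_return X (\<lambda>i. W (i + x)) m y x"
proof
  show "card X = 2" "range (\<lambda>i. W (i + x)) \<subseteq> X" "0 < y" "0 < x"
    using card_X W_in x_pos y_pos by auto
  have *: "window (\<lambda>i. W (i + x)) i l = window W (i + x) l" for i l
    by (simp add: window_def algebra_simps)
  show "W (i + (y + x) + x) = W (i + x)" for i
    using period[of "i + x"] by (simp add: algebra_simps)
  show "window (\<lambda>i. W (i + x)) y m = window (\<lambda>i. W (i + x)) 0 m"
    using window_cong[of "y + x" 0 m] return by (simp add: * add.commute)
  show "y + x dvd p - q"
    if "window (\<lambda>i. W (i + x)) p (Suc m) = window (\<lambda>i. W (i + x)) q (Suc m)" for p q
    using maximal[of "p + x" "q + x"] that by (simp add: * add.commute)
qed

section \<open>Words avoiding \<open>core\<close>\<close>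

text \<open>
  Avoiding \<open>core\<close> forces a word to follow \<open>W\<close>, except that after an occurrence of \<open>w\<close> it may
  switch between the two returns.
\<close>

lemma factor_window_if_core:
  assumes "range W' \<subseteq> X" "satisfies W' core" "l \<le> Suc m"
  shows "factor (window W' s l) W"
  using assms(3)
proof (induction l arbitrary: s)
  case (Suc l)
  show ?case
  proof (rule ccontr)
    assume "\<not> ?thesis"
    then have "window W' s (Suc l) \<in> mfw X W"
      using Suc range_window[OF assms(1), of s "Suc l"] by (simp add: mfw_window)
    then have "window W' s (Suc l) \<in> core"
      using Suc.prems by (intro mfw_short) auto
    then show False
      using assms(2) by (auto simp: satisfies_def)
  qed
qed simp

text \<open>A window of length \<open>m + 2\<close> foreign to \<open>W\<close> would be minimal
  forbidden and outside \<open>core\<close>, hence \<open>bad1\<close> or \<open>bad2\<close>. Then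
  \<open>w\<close> would occur in \<open>W\<close> at \<open>i + 1\<close>, which the last two
  assumptions exclude.\<close>

lemma follow:
  assumes "range W' \<subseteq> X" "satisfies W' core"
    and eq: "window W' s (Suc m) = window W i (Suc m)"
    and "\<not> x + y dvd i + 1" "\<not> x + y dvd i + 1 - x"
  shows "window W' (s + 1) (Suc m) = window W (i + 1) (Suc m)"
proof (cases "factor (window W' s (Suc (Suc m))) W")
  case True
  then obtain r where r: "window W' s (Suc (Suc m)) = window W r (Suc (Suc m))"
    by (auto simp: factor_iff_window)
  then have "window W r (Suc m) = window W i (Suc m)"
    using eq by (metis butlast_window)
  then have "x + y dvd (r + 1) - (i + 1)"
    using maximal by simp
  then show ?thesis
    using r window_cong by (metis tl_window)
next
  case False
  then have "window W' s (Suc (Suc m)) \<in> mfw X W"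
    using range_window[OF assms(1), of s "Suc (Suc m)"] factor_window_if_core[OF assms(1,2)]
    by (simp add: mfw_window)
  moreover have "window W' s (Suc (Suc m)) \<notin> core"
    using assms(2) by (auto simp: satisfies_def)
  ultimately have "window W' s (Suc (Suc m)) \<in> {bad1, bad2}"
    by (auto simp: core_def)
  moreover have "tl (butlast bad1) = w" "tl (butlast bad2) = w"
    by (simp_all add: bad1_def bad2_def butlast_append)
  ultimately have "tl (butlast (window W' s (Suc (Suc m)))) = w"
    by fastforce
  then have "window W (i + 1) m = w"
    using eq unfolding butlast_window by simp
  then show ?thesis
    using occurrence_w assms(4,5) by blast
qed

section \<open>The loop of length \<open>x\<close>\<close>

definition "loop i = W (i mod x)"

lemma loop_in: "range loop \<subseteq> X"
  using W_in by (auto simp: loop_def)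

text \<open>By \<open>return\<close>, \<open>W\<close> has local period \<open>x\<close> on this
  whole range.\<close>

lemma loop_eq: "0 \<le> t \<Longrightarrow> t < x + int m \<Longrightarrow> loop t = W t"
proof (induction "nat t" arbitrary: t rule: less_induct)
  case less
  show ?case
  proof (cases "t < x")
    case True
    then show ?thesis using less by (simp add: loop_def)
  next
    case False
    have "loop t = loop (t - x)"
      by (simp add: loop_def)
    also have "\<dots> = W (t - x)"
      using less False x_pos by (intro less.hyps) auto
    also have "\<dots> = W t"
      using window_eqD[OF return, of "nat (t - x)"] less False by simp
    finally show ?thesis .
  qed
qed

lemma mod_x: "0 \<le> s mod x" "s mod x < x"
  using x_pos by auto

lemma window_loop_mod: "window loop s l = window loop (s mod x) l"
  by (simp add: window_eq_iff loop_def mod_simps)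

lemma window_loop: "0 \<le> i \<Longrightarrow> i + int l \<le> x + int m \<Longrightarrow> window loop i l = window W i l"
  by (auto simp: window_eq_iff intro!: loop_eq)

lemma window_loop_Suc: "window loop s (Suc m) = window W (s mod x) (Suc m)"
proof -
  have "0 \<le> s mod x" "s mod x + int (Suc m) \<le> x + int m"
    using mod_x[of s] by linarith+
  then show ?thesis
    using window_loop window_loop_mod by metis
qed

lemma loop_period: "(\<And>i. loop (i + k) = loop i) \<Longrightarrow> x dvd k"
proof -
  assume *: "\<And>i. loop (i + k) = loop i"
  have "window loop k (Suc m) = window loop 0 (Suc m)"
    using *[of "int _"] by (simp add: window_eq_iff add.commute)
  then have "x + y dvd k mod x"
    using maximal[of "k mod x" 0] window_loop_Suc[of k] window_loop_Suc[of 0] by simp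
  then have "k mod x = 0"
    using mod_x[of k] y_pos by (intro small_dvd) linarith+
  then show ?thesis by auto
qed

text \<open>A window of \<open>loop\<close> of length at most \<open>m + 2\<close>, started at
  \<open>i\<close> in \<open>[0, x)\<close>, stays in the range where \<open>loop\<close> agrees
  with \<open>W\<close>. The one exception is the window of length \<open>m + 2\<close> at
  \<open>x - 1\<close>, which is \<open>bad1\<close>.\<close>

lemma loop_satisfies_core: "satisfies loop core"
  unfolding satisfies_def
proof (intro ballI notI)
  fix z assume z: "z \<in> core" "factor z loop"
  then have zm: "z \<in> mfw X W" "z \<noteq> bad1" and nW: "\<not> factor z W"
    by (auto simp: core_def mfw_def)
  obtain s where s: "z = window loop s (length z)"
    using z by (auto simp: factor_iff_window)
  define i where "i = s mod x"
  have i: "0 \<le> i" "i < x"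
    using x_pos by (auto simp: i_def)
  have zi: "z = window loop i (length z)"
    using s window_loop_mod[of s] by (metis i_def)
  consider "length z \<le> Suc m \<or> i < x - 1" | "length z = Suc (Suc m)" "i = x - 1"
    using length_mfw_le[OF zm(1)] i by linarith
  then show False
  proof cases
    case 1
    then have "z = window W i (length z)"
      using zi window_loop[of i "length z"] i length_mfw_le[OF zm(1)] by fastforce
    then show False
      using nW factor_window by metis
  next
    case 2
    then have "z = window loop i (Suc (Suc m))"
      using zi by simp
    also have "\<dots> = loop i # window loop (i + 1) (Suc m)"
      by (rule window_Suc)
    also have "loop i = W (x - 1)"
      using i 2 loop_eq[of i] by simp
    also have "window loop (i + 1) (Suc m) = window W 0 (Suc m)"
      using 2 by (simp add: window_loop_Suc)
    finally show False
      using zm(2) by (simp add: bad1_def right_0)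
  qed
qed

lemma not_factor_loop: "\<not> factor (window W (-1) (Suc m)) loop"
proof
  assume "factor (window W (-1) (Suc m)) loop"
  then obtain s where "window W (-1) (Suc m) = window W (s mod x) (Suc m)"
    by (auto simp: factor_iff_window window_loop_Suc)
  then have "x + y dvd s mod x - (-1)"
    using maximal by metis
  then have "s mod x - (-1) = 0"
    using mod_x[of s] y_pos by (intro small_dvd) linarith+
  then show False
    using mod_x(1)[of s] by linarith
qed

text \<open>Each window of length \<open>m + 1\<close> in \<open>W'\<close> is the window of
  \<open>W\<close> at some \<open>j s\<close> in \<open>[0, x)\<close>, and \<open>j\<close>
  advances by one modulo \<open>x\<close>.\<close>

lemma loop_unique:
  assumes rW': "range W' \<subseteq> X" and sat: "satisfies W' core"
    and nf: "\<not> factor (window W (-1) (Suc m)) W'"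
  shows "shift_equiv loop W'"
proof -
  \<comment> \<open>From a position in \<open>[x, x + y)\<close> there is no branching before
    position \<open>x + y - 1\<close>, where the forbidden word \<open>W (-1) # w\<close> is
    read.\<close>
  have late: False
    if "x \<le> i" "i + int k = x + y - 1" "window W' s (Suc m) = window W i (Suc m)" for k i s
    using that
  proof (induction k arbitrary: i s)
    case 0
    then have "window W i (Suc m) = window W (-1) (Suc m)"
      by (intro window_cong) auto
    then show ?case
      using 0 nf by (metis factor_window)
  next
    case (Suc k)
    have "\<not> x + y dvd i + 1" "\<not> x + y dvd i + 1 - x"
      using small_dvd[of "i + 1"] small_dvd[of "i + 1 - x"] Suc x_pos y_pos by auto
    then have "window W' (s + 1) (Suc m) = window W (i + 1) (Suc m)"
      using follow[OF rW' sat Suc.prems(3)] by blast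
    then show False
      using Suc.IH[of "i + 1" "s + 1"] Suc.prems by simp
  qed
  have "\<exists>i. 0 \<le> i \<and> i < x \<and> window W' s (Suc m) = window W i (Suc m)" for s
  proof -
    obtain r where r: "window W' s (Suc m) = window W r (Suc m)"
      using factor_window_if_core[OF rW' sat, of "Suc m" s] by (auto simp: factor_iff_window)
    define i where "i = r mod (x + y)"
    have "window W' s (Suc m) = window W i (Suc m)"
      unfolding r by (intro window_cong) (simp add: i_def mod_eq_dvd_iff[symmetric])
    moreover have "0 \<le> i" "i < x + y"
      using x_pos y_pos by (auto simp: i_def)
    moreover have "i < x"
      using late[of i "nat (x + y - 1 - i)" s] calculation by (cases "i < x") auto
    ultimately show ?thesis by blast
  qed
  then obtain j where j: "\<And>s. 0 \<le> j s" "\<And>s. j s < x"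
    "\<And>s. window W' s (Suc m) = window W (j s) (Suc m)"
    by metis
  have step: "j (s + 1) = (j s + 1) mod x" for s
  proof (cases "j s + 1 < x")
    case True
    have "\<not> x + y dvd j s + 1" "\<not> x + y dvd j s + 1 - x"
      using small_dvd[of "j s + 1"] small_dvd[of "j s + 1 - x"] True j(1)[of s] x_pos y_pos by auto
    then have "window W (j (s + 1)) (Suc m) = window W (j s + 1) (Suc m)"
      using follow[OF rW' sat j(3)] j(3) by metis
    then have "x + y dvd j (s + 1) - (j s + 1)"
      by (rule maximal)
    then have "j (s + 1) - (j s + 1) = 0"
      using j(1,2)[of s] j(1,2)[of "s + 1"] True y_pos by (intro small_dvd) auto
    then show ?thesis using True j(1)[of s] by simp
  next
    case False
    \<comment> \<open>At the end of the loop the next window starts with \<open>w\<close>; of its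
      two possible positions 0 and \<open>x\<close>, only 0 lies in the range of
      \<open>j\<close>.\<close>
    then have js: "j s = x - 1"
      using j(2)[of s] by simp
    have "window W' (s + 1) m = window W (j s + 1) m"
      using j(3)[of s] by (metis tl_window)
    then have "window W (j (s + 1)) m = w"
      using js return window_eq_prefix[OF j(3)[of "s + 1"], of m] by simp
    then have "x + y dvd j (s + 1) \<or> x + y dvd j (s + 1) - x"
      by (rule occurrence_w)
    then have "j (s + 1) = 0 \<or> j (s + 1) - x = 0"
      using small_dvd[of "j (s + 1)"] small_dvd[of "j (s + 1) - x"]
        j(1,2)[of "s + 1"] y_pos x_pos by auto
    then show ?thesis
      using js j(2)[of "s + 1"] by auto
  qed
  have js: "j s = (j 0 + s) mod x" for s
  proof (induction s rule: int_induct[where k = 0])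
    case base
    then show ?case using j(1,2)[of 0] by simp
  next
    case (step1 i)
    then show ?case using step[of i] by (simp add: mod_simps algebra_simps)
  next
    case (step2 i)
    have "j i = (j (i - 1) + 1) mod x"
      using step[of "i - 1"] by simp
    then have "(j (i - 1) + 1 - 1) mod x = (j 0 + i - 1) mod x"
      using step2 by (metis mod_diff_left_eq)
    then show ?case
      using j(1,2)[of "i - 1"] by (simp add: algebra_simps)
  qed
  have "W' s = loop (s + j 0)" for s
    using window_eqD[OF j(3), of 0 s] js[of s] by (metis add.commute add_0_right loop_def of_nat_0 zero_less_Suc)
  then show ?thesis
    by (auto simp: shift_equiv_def)
qed

lemma defines_loop:
  assumes "satisfies loop V"
    and "\<And>W'. range W' \<subseteq> X \<Longrightarrow> satisfies W' V \<Longrightarrow>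
      satisfies W' core \<and> \<not> factor (window W (-1) (Suc m)) W'"
  shows "defines_word X V loop"
  using assms loop_in loop_unique by (auto simp: defines_word_def)

text \<open>\<open>core\<close> together with \<open>W (-1) # w\<close> defines \<open>loop\<close>:
  one word takes the place of \<open>bad1\<close> and \<open>bad2\<close>.\<close>

lemma card_mfw_loop:
  assumes "finite (mfw X W)"
  shows "finite (mfw X loop) \<and> Suc (card (mfw X loop)) \<le> card (mfw X W)"
proof -
  define V where "V = insert (window W (-1) (Suc m)) core"
  have fin: "finite core"
    using assms by (simp add: core_def)
  then have "finite V"
    by (simp add: V_def)
  moreover have "defines_word X V loop"
    by (rule defines_loop)
      (use loop_satisfies_core not_factor_loop in \<open>auto simp: satisfies_def V_def\<close>)
  ultimately have "finite (mfw X loop) \<and> card (mfw X loop) \<le> card V"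
    by (rule card_mfw_le)
  moreover have "card V \<le> Suc (card core)"
    using fin by (simp add: V_def card_insert_if)
  ultimately show ?thesis
    using card_core[OF assms] by simp
qed

section \<open>The cheaper defining set for the short loop\<close>

text \<open>Otherwise \<open>return\<close> would cover all residues modulo \<open>x + y\<close> and
  make \<open>x\<close> a period of \<open>W\<close>.\<close>

lemma m_less: "int m < x + y"
proof (rule ccontr)
  assume "\<not> ?thesis"
  then have m: "x + y \<le> int m" by simp
  have *: "W t = W (x + t)" for t
  proof -
    define r where "r = t mod (x + y)"
    have r: "0 \<le> r" "r < x + y"
      using x_pos y_pos by (auto simp: r_def)
    have "x + y dvd t - r"
      by (simp add: r_def)
    then have "W t = W r" "W (x + t) = W (x + r)"
      by (auto intro!: W_cong)
    moreover have "W r = W (x + r)"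
      using window_eqD[OF return, of "nat r"] r m by simp
    ultimately show ?thesis by simp
  qed
  have "window W x (Suc m) = window W 0 (Suc m)"
    unfolding window_eq_iff add_0 by (simp only: *[of "int _"] simp_thms)
  then show False
    using maximal[of x 0] not_dvd_x by simp
qed

text \<open>Extend two incongruent occurrences to a longest pair of equal windows. Crossing their
  outer letters gives a minimal forbidden word containing the given one; not being in
  \<open>core\<close>, it is \<open>bad1\<close> or \<open>bad2\<close>, so its middle is
  \<open>w\<close>, which does not contain the given word.\<close>

lemma unique_occurrence:
  assumes nw: "\<not> sublist (window W p0 L) w"
    and ncore: "\<And>f. f \<in> core \<Longrightarrow> \<not> sublist (window W p0 L) f"
    and occ: "window W p L = window W p0 L" "window W q L = window W p0 L"
  shows "x + y dvd p - q"
proof (rule ccontr)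
  assume ndvd: "\<not> x + y dvd p - q"
  \<comment> \<open>\<open>k\<close> is the offset of the given word inside the common window;
    \<open>maximal\<close> bounds \<open>l\<close> by \<open>m\<close>.\<close>
  define P where "P l \<longleftrightarrow> (\<exists>a b k. \<not> x + y dvd a - b \<and> window W a l = window W b l \<and>
    k + L \<le> l \<and> window W (a + int k) L = window W p0 L)" for l
  have "P L"
    unfolding P_def using ndvd occ by (intro exI[of _ p] exI[of _ q] exI[of _ 0]) auto
  moreover have bound: "l \<le> m" if "P l" for l
  proof (rule ccontr)
    assume "\<not> l \<le> m"
    then show False
      using that maximal window_eq_prefix[of W _ l W _ "Suc m"] unfolding P_def
      by (metis not_less_eq_eq)
  qed
  ultimately obtain l where l: "P l" "\<And>l'. P l' \<Longrightarrow> l' \<le> l"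
    using GreatestI_nat[of P L m] Greatest_le_nat[of P _ m] by metis
  then obtain a b k where ab: "\<not> x + y dvd a - b" "window W a l = window W b l" "k + L \<le> l"
    "window W (a + int k) L = window W p0 L"
    by (auto simp: P_def)
  have nP: "x + y dvd a' - b'" if "window W a' (Suc l) = window W b' (Suc l)" "k' + L \<le> Suc l"
    "window W (a' + int k') L = window W p0 L" for a' b' k'
    using l(2)[of "Suc l"] that unfolding P_def by auto
  have bk: "window W (b + int k) L = window W p0 L"
    using window_eq_sub[OF ab(2,3)] ab(4) by simp
  define z where "z = W (a - 1) # window W a l @ [W (b + int l)]"
  have az: "W (a - 1) # window W a l = window W (a - 1) (Suc l)"
    by (simp add: window_Suc)
  have bz: "window W a l @ [W (b + int l)] = window W b (Suc l)"
    using ab(2) by (simp add: window_Suc')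
  have "\<not> factor z W"
  proof
    assume "factor z W"
    then obtain r where r: "z = window W r (Suc (Suc l))"
      by (auto simp: factor_iff_window z_def)
    have "window W (r + 1) (Suc l) = window W b (Suc l)"
      using r bz by (simp add: z_def window_Suc[of W r "Suc l"])
    moreover from this have "window W (r + 1 + int k) L = window W p0 L"
      using window_eq_sub[of W "r + 1" "Suc l" W b k L] ab(3) bk by simp
    ultimately have 1: "x + y dvd r + 1 - b"
      using ab(3) by (intro nP[of _ _ k]) auto
    have "butlast z = W (a - 1) # window W a l"
      by (simp add: z_def butlast_append)
    then have "window W r (Suc l) = window W (a - 1) (Suc l)"
      using r az butlast_window by metis
    then have "x + y dvd (a - 1) - r"
      using ab(3,4) by (intro nP[of _ _ "Suc k"]) auto
    then have "x + y dvd (r + 1 - b) + ((a - 1) - r)"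
      using 1 dvd_add by blast
    then show False
      using ab(1) by simp
  qed
  then have "z \<in> mfw X W"
    using W_in range_window[OF range_W, of a l] az bz factor_window
    unfolding z_def mfw_iff by metis
  moreover have sub: "sublist (window W p0 L) (window W a l)"
    using sublist_window[of a "a + int k" L l W] ab by simp
  have "sublist (window W a l) z"
    unfolding z_def sublist_def by (metis append_Cons append_Nil)
  then have "z \<notin> core"
    using ncore sub sublist_order.order_trans by blast
  ultimately have "z \<in> {bad1, bad2}"
    by (auto simp: core_def)
  then have "window W a l = w"
    by (auto simp: z_def bad1_def bad2_def)
  then show False
    using sub nw by simp
qed

text \<open>
  Take for \<open>e\<close> the shortest prefix of \<open>W (-1) # w\<close> avoided by the loop. If no word of \<open>core\<close>
  contained \<open>e\<close>, the occurrences of \<open>e\<close> would be unique modulo the period, and \<open>e\<close> would also be a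
  suffix of \<open>w @ [W (x + m)]\<close>. This makes \<open>w\<close> overlap itself both at distance \<open>x\<close> and at distance
  \<open>y\<close>; as \<open>x \<le> y\<close>, the overlap at distance \<open>x\<close>, extended by one letter on each side, has \<open>e\<close> both
  as a prefix and as a suffix, so it can be neither a factor of \<open>W\<close> nor an element of \<open>core\<close>.
\<close>

lemma core_contains_loop_avoiding:
  assumes "x \<le> y" "2 \<le> x"
  obtains e f where "f \<in> core" "sublist e f" "sublist e (window W (-1) (Suc m))" "\<not> factor e loop"
proof -
  define L where "L = (LEAST l. \<not> factor (window W (-1) l) loop)"
  have nf: "\<not> factor (window W (-1) L) loop" and Lm: "L \<le> Suc m"
    unfolding L_def using not_factor_loop by (rule LeastI, rule Least_le)
  have pre: "factor (window W (-1) l) loop" if "l < L" for l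
    using not_less_Least that unfolding L_def by blast
  have "L \<noteq> 0"
    using nf by (metis window_0 factor_Nil)
  \<comment> \<open>Here \<open>2 <= x\<close> enters: \<open>loop\<close> has exact period
    \<open>x\<close>, so it is not constant and contains both letters.\<close>
  moreover have "L \<noteq> 1"
  proof
    assume "L = 1"
    have "\<exists>i. loop i \<noteq> loop 0"
    proof (rule ccontr)
      assume "\<not> ?thesis"
      then have "x dvd 1"
        by (intro loop_period) metis
      then show False
        using assms zdvd_imp_le[of x 1] by simp
    qed
    then obtain i where i: "loop i \<noteq> loop 0" by blast
    then have "X = {loop i, loop 0}"
      by (intro card_2_eq[OF card_X]) (use loop_in in auto)
    then have "W (-1) = loop i \<or> W (-1) = loop 0"
      using W_in by blast
    then have "window W (-1) L = window loop i 1 \<or> window W (-1) L = window loop 0 1"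
      using \<open>L = 1\<close> by (simp add: window_Suc)
    then show False
      using nf by (metis factor_window)
  qed
  ultimately have L2: "2 \<le> L" by simp
  define e where "e = window W (-1) L"
  have sub_left: "sublist e (window W (-1) (Suc m))"
    unfolding e_def by (rule sublist_window) (use Lm in auto)
  have w_loop: "window loop 0 (Suc m) = window W 0 (Suc m)"
    by (simp add: window_loop_Suc)
  have "factor w loop"
    using window_eq_prefix[OF w_loop, of m] factor_window[of loop 0 m] by simp
  then have nw: "\<not> sublist e w"
    using nf factor_sublist unfolding e_def by blast
  have "\<exists>f\<in>core. sublist e f"
  proof (rule ccontr)
    assume "\<not> ?thesis"
    then have ncore: "\<not> sublist e f" if "f \<in> core" for f
      using that by blast
    have unique: "x + y dvd p - q" if "window W p L = e" "window W q L = e" for p q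
      using unique_occurrence[of "-1" L p q] nw ncore that unfolding e_def by blast
    \<comment> \<open>Without its last letter \<open>e\<close> occurs in \<open>loop\<close>, hence
      in \<open>W\<close> at some \<open>q\<close> in \<open>[0, x)\<close>, where a different
      letter follows.\<close>
    obtain s where s: "window W (-1) (L - 1) = window loop s (L - 1)"
      using pre[of "L - 1"] L2 by (auto simp: factor_iff_window)
    define q where "q = s mod x"
    have q: "window W q L = window loop s L"
      unfolding q_def using window_eq_prefix[OF window_loop_Suc Lm, of s] by simp
    then have q': "window W q (L - 1) = window W (-1) (L - 1)"
      using s window_eq_prefix[of W q L loop s "L - 1"] by simp
    have "window W q L \<noteq> e"
      using q nf factor_window unfolding e_def by metis
    then have qL: "W (q + int (L - 1)) \<noteq> W (-1 + int (L - 1))"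
      using q' L2 window_Suc'[of W q "L - 1"] window_Suc'[of W "-1" "L - 1"] unfolding e_def by force
    \<comment> \<open>The occurrences at \<open>q\<close> and \<open>-1\<close> of \<open>e\<close>
      without its last letter agree for exactly \<open>g\<close> more letters to the left.\<close>
    define g where "g = (LEAST g. W (- 2 - int g) \<noteq> W (q - 1 - int g))"
    have "\<exists>g. W (- 2 - int g) \<noteq> W (q - 1 - int g)"
    proof (rule ccontr)
      assume "\<not> ?thesis"
      then have *: "W (- 2 - int g) = W (q - 1 - int g)" for g by blast
      have "window W (- 2 - int m) (Suc m) = window W (q - 1 - int m) (Suc m)"
        unfolding window_eq_iff
      proof (intro allI impI)
        fix t assume "t < Suc m"
        then show "W (- 2 - int m + int t) = W (q - 1 - int m + int t)"
          using *[of "m - t"] by (simp add: of_nat_diff algebra_simps)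
      qed
      then have "x + y dvd (- 2 - int m) - (q - 1 - int m)"
        by (rule maximal)
      then have "x + y dvd (-1 + int (L - 1)) - (q + int (L - 1))"
        by (simp add: algebra_simps)
      then show False
        using qL W_cong by metis
    qed
    then have g: "W (- 2 - int g) \<noteq> W (q - 1 - int g)"
      unfolding g_def by (rule LeastI_ex)
    have gl: "W (- 2 - int h) = W (q - 1 - int h)" if "h < g" for h
      using that not_less_Least unfolding g_def by blast
    define l where "l = g + (L - 1)"
    have u: "window W (q - int g) l = window W (-1 - int g) l"
      unfolding window_eq_iff
    proof (intro allI impI)
      fix t assume t: "t < l"
      show "W (q - int g + int t) = W (-1 - int g + int t)"
      proof (cases "t < g")
        case True
        then show ?thesis
          using gl[of "g - 1 - t"] by (simp add: of_nat_diff algebra_simps)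
      next
        case False
        then show ?thesis
          using window_eqD[OF q', of "t - g"] t by (simp add: l_def of_nat_diff algebra_simps)
      qed
    qed
    \<comment> \<open>The left letter comes from the occurrence at \<open>q\<close>, the right one
      from the occurrence at \<open>-1\<close>. So \<open>z\<close> ends in \<open>e\<close>, and
      uniqueness of \<open>e\<close> makes it forbidden.\<close>
    define z where "z = W (q - int g - 1) # window W (q - int g) l @ [W (-1 + int (L - 1))]"
    have lz: "W (q - int g - 1) # window W (q - int g) l = window W (q - int g - 1) (Suc l)"
      by (simp add: window_Suc)
    have rz: "window W (q - int g) l @ [W (-1 + int (L - 1))] = window W (-1 - int g) (Suc l)"
      using u by (simp add: window_Suc' l_def)
    have e_off: "window W (r + int g) L = e" if "window W r (Suc l) = window W (-1 - int g) (Suc l)" for r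
      using window_eq_sub[OF that, of g L] L2 by (simp add: l_def e_def)
    have "\<not> factor z W"
    proof
      assume "factor z W"
      then obtain r where r: "z = window W r (Suc (Suc l))"
        by (auto simp: factor_iff_window z_def)
      then have r1: "W r = W (q - int g - 1)" "window W (r + 1) (Suc l) = window W (-1 - int g) (Suc l)"
        using rz by (simp_all add: z_def window_Suc[of W r "Suc l"])
      have "x + y dvd (r + 1 + int g) - (-1)"
        using e_off[OF r1(2)] by (intro unique) (auto simp: e_def)
      then have "W r = W (- 2 - int g)"
        by (intro W_cong) (simp add: algebra_simps)
      then show False
        using r1(1) g by (simp add: algebra_simps)
    qed
    then have "z \<in> mfw X W"
      using W_in range_window[OF range_W, of "q - int g" l] lz rz factor_window
      unfolding z_def mfw_iff by metis
    moreover have "sublist e (window W (-1 - int g) (Suc l))"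
      unfolding e_def by (rule sublist_window) (use L2 in \<open>auto simp: l_def\<close>)
    then have "sublist e z"
      unfolding z_def rz by (simp add: sublist_Cons_right)
    then have "z \<notin> core"
      using ncore by blast
    ultimately have "z = bad1 \<or> z = bad2"
      by (auto simp: core_def)
    then have "window W (-1 - int g) (Suc l) = window W 0 (Suc m) \<or>
        window W (-1 - int g) (Suc l) = window W x (Suc m)" and lm: "l = m"
      unfolding rz[symmetric] right_0 right_x
      by (auto simp: z_def bad1_def bad2_def dest: arg_cong[of _ _ length])
    moreover have "window W (-1 - int g) (Suc l) \<noteq> window W 0 (Suc m)"
    proof
      assume "window W (-1 - int g) (Suc l) = window W 0 (Suc m)"
      then have "sublist e (window loop 0 (Suc m))"
        using \<open>sublist e (window W (-1 - int g) (Suc l))\<close> w_loop by simp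
      then show False
        using nf factor_sublist[OF factor_window] unfolding e_def by blast
    qed
    ultimately have right: "window W x (Suc l) = window W (-1 - int g) (Suc l)"
      by simp
    have ex: "window W (x + int g) L = e"
      by (rule e_off[OF right])
    then have "x + y dvd (x + int g) - (-1)"
      by (intro unique) (auto simp: e_def)
    then have "x + y dvd (x + int g) - (-1) - (x + y)"
      by (rule dvd_diff[OF _ dvd_refl])
    \<comment> \<open>\<open>g < m < x + y\<close> leaves only one multiple of the period.\<close>
    then have "int g + 1 - y = 0"
      using small_dvd[of "int g + 1 - y"] L2 lm m_less x_pos y_pos
      by (simp add: l_def algebra_simps)
    then have gy: "int g = y - 1" by simp
    have my: "int m = y - 2 + int L"
      using gy lm L2 by (simp add: l_def of_nat_diff)
    show False
    proof (cases "x = y")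
      case True
      \<comment> \<open>With equal returns, \<open>x + m\<close> and \<open>m - x\<close> are
        congruent, so the repetition of \<open>w\<close> at \<open>x\<close> would extend by one
        letter, against \<open>maximal\<close>.\<close>
      have "window W (x + 0) (Suc m) = window W 0 (Suc m)"
        unfolding window_eq_iff
      proof (intro allI impI)
        fix t assume t: "t < Suc m"
        show "W (x + 0 + int t) = W (0 + int t)"
        proof (cases "t < m")
          case True
          then show ?thesis using window_eqD[OF return, of t] by simp
        next
          case False
          then have tm: "t = m" using t by simp
          have "W (x + int m) = W (int m - x)"
            using True by (intro W_cong) simp
          also have "\<dots> = W (int m)"
          proof -
            have "0 \<le> int m - x"
              using my True L2 by simp
            then show ?thesis
              using window_eqD[OF return, of "nat (int m - x)"] x_pos by simp
          qed
          finally show ?thesis using tm by simp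
        qed
      qed
      then show False
        using maximal[of x 0] not_dvd_x by simp
    next
      case False
      then have xy: "x < y" using assms by simp
      \<comment> \<open>\<open>b\<close> is the length of the overlap of the occurrences of
        \<open>w\<close> at 0 and \<open>x\<close>; the word \<open>v\<close> below is this overlap
        with one letter added on each side.\<close>
      define b where "b = nat (int m - x)"
      have b: "int b = int m - x"
        using my xy L2 by (simp add: b_def)
      have r2: "window W 0 b @ [W (x + int m)] = window W (2 * x) (Suc b)"
      proof -
        have "W (2 * x + int t) = W (int t)" if "t < b" for t
        proof -
          have "W (x + int (nat (x + int t))) = W (0 + int (nat (x + int t)))"
            using that b x_pos by (intro window_eqD[OF return]) auto
          then have "W (2 * x + int t) = W (x + int t)"
            using x_pos by (simp add: algebra_simps)
          also have "\<dots> = W (int t)"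
            using window_eqD[OF return, of t] that b x_pos by simp
          finally show ?thesis .
        qed
        then have "window W 0 b = window W (2 * x) b"
          by (simp add: window_eq_iff)
        then show ?thesis
          using b by (simp add: window_Suc')
      qed
      define v where "v = W (-1) # window W 0 b @ [W (x + int m)]"
      have lv: "W (-1) # window W 0 b = window W (-1) (Suc b)"
        by (simp add: window_Suc)
      have Lb: "int L = int b + 2 + x - y"
        using my b by simp
      have "sublist e (window W (-1) (Suc b))"
        unfolding e_def by (rule sublist_window) (use Lb xy in auto)
      then have "sublist e v"
        unfolding v_def using lv
        by (metis append_Cons sublist_appendI sublist_append_rightI sublist_order.order_trans)
      then have "v \<notin> core"
        using ncore by blast
      moreover have "v \<in> mfw X W" if "\<not> factor v W"
        using that W_in range_window[OF range_W, of 0 b] lv r2 factor_window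
        unfolding v_def mfw_iff by metis
      moreover have "length v \<noteq> Suc (Suc m)"
        using b x_pos by (simp add: v_def)
      ultimately have "factor v W"
        using mfw_short by blast
      then obtain r where r: "v = window W r (Suc (Suc b))"
        by (auto simp: factor_iff_window v_def)
      have "butlast v = window W (-1) (Suc b)"
        unfolding v_def lv[symmetric] by (simp add: butlast_append)
      then have "window W r (Suc b) = window W (-1) (Suc b)"
        using r by (metis butlast_window)
      then have 1: "window W r L = e"
        unfolding e_def by (rule window_eq_prefix) (use Lb xy in auto)
      \<comment> \<open>Since \<open>k + L = b + 1\<close>, this offset places \<open>e\<close> at
        the very end of \<open>v\<close>. With \<open>e\<close> also a prefix of \<open>v\<close>,
        two occurrences are at distance \<open>y - x\<close>, strictly between 0 and the
        period.\<close>
      define k where "k = nat (y - 1 - x)"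
      have k: "int k = y - 1 - x"
        using xy by (simp add: k_def)
      have "window W (r + 1) (Suc b) = window W (2 * x) (Suc b)"
        using r r2 by (simp add: v_def window_Suc[of W r "Suc b"])
      then have "window W (r + 1 + int k) L = window W (2 * x + int k) L"
        by (rule window_eq_sub) (use k Lb in auto)
      also have "2 * x + int k = x + int g"
        using k gy by simp
      finally have "window W (r + 1 + int k) L = e"
        using ex by simp
      then have "x + y dvd (r + 1 + int k) - r"
        using 1 unique by blast
      then have "y - x = 0"
        using k x_pos xy by (intro small_dvd) auto
      then show False using xy by simp
    qed
  qed
  then show thesis
    using that sub_left nf unfolding e_def by blast
qed

text \<open>Forbidding \<open>e\<close> also forbids \<open>f\<close> and \<open>W (-1) # w\<close>,
  so exchanging \<open>f\<close> for \<open>e\<close> in \<open>core\<close> defines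
  \<open>loop\<close> with no more words than \<open>core\<close> has.\<close>

lemma card_mfw_short_loop:
  assumes fin: "finite (mfw X W)" and "x \<le> y" "2 \<le> x"
  shows "finite (mfw X loop) \<and> Suc (Suc (card (mfw X loop))) \<le> card (mfw X W)"
proof -
  obtain e f where ef: "f \<in> core" "sublist e f" "sublist e (window W (-1) (Suc m))" "\<not> factor e loop"
    using core_contains_loop_avoiding assms by blast
  define V where "V = insert e (core - {f})"
  have finc: "finite core"
    using fin by (simp add: core_def)
  then have "finite V"
    by (simp add: V_def)
  moreover have "defines_word X V loop"
  proof (rule defines_loop)
    show "satisfies loop V"
      using loop_satisfies_core ef(4) by (auto simp: satisfies_def V_def)
    fix W' assume "satisfies W' V"
    then show "satisfies W' core \<and> \<not> factor (window W (-1) (Suc m)) W'"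
      using ef(2,3) factor_sublist unfolding satisfies_def V_def by blast
  qed
  ultimately have "finite (mfw X loop) \<and> card (mfw X loop) \<le> card V"
    by (rule card_mfw_le)
  moreover have "card V \<le> card core"
    using card_Suc_Diff1[OF finc ef(1)] finc by (simp add: V_def card_insert_if)
  ultimately show ?thesis
    using card_core[OF fin] by simp
qed

end

section \<open>Induction on the exact period\<close>

lemma F_mono: "a \<le> b \<Longrightarrow> F a \<le> F b"
  by (simp add: F_def fib_mono)

lemma F_pos: "1 \<le> F a"
  using fib_neq_0_nat[of "Suc a"] by (simp add: F_def)

lemma period_le_F_card_mfw:
  assumes "card X = 2" "range W \<subseteq> X" "0 < n" "\<And>i. W (i + int n) = W i"
    and "\<And>k. (\<And>i. W (i + k) = W i) \<Longrightarrow> int n dvd k"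
    and "finite (mfw X W)"
  shows "n \<le> F (card (mfw X W))"
  using assms(2-)
proof (induction n arbitrary: W rule: less_induct)
  case (less n)
  note per = less.prems(3) and exact = less.prems(4) and fin = less.prems(5)
  show ?case
  proof (cases "n = 1")
    case True
    then show ?thesis using F_pos by simp
  next
    case False
    then have n: "2 \<le> n" using less.prems(2) by simp
    have cong: "window W p l = window W q l" if "int n dvd p - q" for p q l
      unfolding window_eq_iff
    proof (intro allI impI)
      fix t show "W (p + int t) = W (q + int t)"
        by (rule periodic_dvd[of W "int n"]) (use per that in auto)
    qed
    \<comment> \<open>Lengths of words with two incongruent occurrences. They are bounded by
      \<open>n\<close>, since equal windows longer than \<open>n\<close> would make
      \<open>p - q\<close> a period; the greatest one serves as \<open>m\<close>.\<close>
    define P where "P l \<longleftrightarrow> (\<exists>p q. \<not> int n dvd p - q \<and> window W p l = window W q l)" for l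
    have "P 0"
      unfolding P_def using n zdvd_imp_le[of "int n" 1] by (intro exI[of _ 1] exI[of _ 0]) auto
    moreover have "l \<le> n" if "P l" for l
    proof (rule ccontr)
      assume "\<not> l \<le> n"
      obtain p q where pq: "\<not> int n dvd p - q" "window W p l = window W q l"
        using \<open>P l\<close> by (auto simp: P_def)
      have "W (i + (p - q)) = W i" for i
      proof -
        define r where "r = (i - q) mod int n"
        have r: "0 \<le> r" "r < int n" and dvd: "int n dvd (i - q) - r"
          using n by (auto simp: r_def)
        have "W (i + (p - q)) = W (p + r)"
          by (rule periodic_dvd[of W "int n"]) (use per dvd in \<open>auto simp: algebra_simps\<close>)
        also have "\<dots> = W (q + r)"
          using window_eqD[OF pq(2), of "nat r"] r \<open>\<not> l \<le> n\<close> by simp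
        also have "\<dots> = W i"
          by (rule sym, rule periodic_dvd[of W "int n"]) (use per dvd in \<open>auto simp: algebra_simps\<close>)
        finally show ?thesis .
      qed
      then show False using exact pq(1) by blast
    qed
    ultimately obtain m where m: "P m" "\<And>l. P l \<Longrightarrow> l \<le> m"
      using GreatestI_nat[of P 0 n] Greatest_le_nat[of P _ n] by metis
    then obtain p q where pq: "\<not> int n dvd p - q" "window W p m = window W q m"
      by (auto simp: P_def)
    \<comment> \<open>The residue \<open>d\<close> of \<open>p - q\<close> and \<open>n - d\<close>
      are the two returns; \<open>x\<close> is the smaller one, and \<open>b\<close> is the
      occurrence it starts from.\<close>
    obtain b x where bx: "0 < x" "x \<le> int n - x" "window W (b + x) m = window W b m"
    proof -
      define d where "d = (p - q) mod int n"
      have "d \<noteq> 0"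
        using pq(1) by (simp add: d_def dvd_eq_mod_eq_0)
      moreover have "0 \<le> d" "d < int n"
        using n by (simp_all add: d_def)
      moreover have "int n dvd (p - q) - d"
        by (simp add: d_def)
      ultimately have d: "0 < d" "d < int n" "int n dvd (p - q) - d"
        by simp_all
      show thesis
      proof (cases "d \<le> int n - d")
        case True
        have "window W (q + d) m = window W p m"
          by (rule sym, rule cong) (use d(3) in \<open>simp add: algebra_simps\<close>)
        then show thesis
          using that[of d q] d True pq(2) by simp
      next
        case False
        have "window W (p + (int n - d)) m = window W q m"
          by (rule cong) (use dvd_add[OF dvd_refl d(3)] in \<open>simp add: algebra_simps\<close>)
        then show thesis
          using that[of "int n - d" p] d False pq(2) by simp
      qed
    qed
    define W1 where "W1 i = W (i + b)" for i
    have win: "window W1 i l = window W (i + b) l" for i l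
      by (simp add: window_def W1_def algebra_simps)
    have mfw1: "mfw X W1 = mfw X W"
      unfolding W1_def by (rule mfw_shift)
    interpret A: double_return X W1 m x "int n - x"
    proof
      show "card X = 2" "range W1 \<subseteq> X" "0 < x" "0 < int n - x"
        using assms(1) less.prems(1) bx by (auto simp: W1_def)
      show "W1 (i + (x + (int n - x))) = W1 i" for i
        using per[of "i + b"] by (simp add: W1_def algebra_simps)
      show "window W1 x m = window W1 0 m"
        using bx(3) by (simp add: win add.commute)
      show "x + (int n - x) dvd p - q" if "window W1 p (Suc m) = window W1 q (Suc m)" for p q
      proof (rule ccontr)
        assume "\<not> ?thesis"
        then have "\<not> int n dvd (p + b) - (q + b)" by simp
        then have "P (Suc m)"
          using that unfolding P_def win by blast
        then show False using m(2) by fastforce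
      qed
    qed
    \<comment> \<open>The same configuration seen from the second occurrence: \<open>B.loop\<close>
      is the long loop, \<open>A.loop\<close> the short one.\<close>
    interpret B: double_return X "\<lambda>i. W1 (i + x)" m "int n - x" x
      by (rule A.double_return_shift)
    define k where "k = card (mfw X W)"
    have k: "2 \<le> k"
      using A.card_core fin by (simp add: k_def mfw1)
    have B: "finite (mfw X B.loop)" "Suc (card (mfw X B.loop)) \<le> k"
      using B.card_mfw_loop fin by (auto simp: k_def mfw_shift mfw1)
    have "nat (int n - x) \<le> F (card (mfw X B.loop))"
    proof (rule less.IH)
      show "nat (int n - x) < n" "0 < nat (int n - x)"
        using bx by auto
      show "range B.loop \<subseteq> X"
        by (rule B.loop_in)
      show "B.loop (i + int (nat (int n - x))) = B.loop i" for i
        using bx by (simp add: B.loop_def)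
      show "int (nat (int n - x)) dvd j" if "\<And>i. B.loop (i + j) = B.loop i" for j
      proof -
        have "int n - x dvd j"
          using that by (rule B.loop_period)
        then show ?thesis
          using bx by simp
      qed
      show "finite (mfw X B.loop)"
        by (rule B(1))
    qed
    also have "\<dots> \<le> F (k - 1)"
      by (rule F_mono) (use B in simp)
    finally have y: "nat (int n - x) \<le> F (k - 1)" .
    have "nat x \<le> F (k - 2)"
    \<comment> \<open>The exchange of words requires \<open>2 <= x\<close>; a return of length 1 is
      covered by \<open>F_pos\<close>.\<close>
    proof (cases "x = 1")
      case True
      then show ?thesis using F_pos by simp
    next
      case False
      then have A: "finite (mfw X A.loop)" "Suc (Suc (card (mfw X A.loop))) \<le> k"
        using A.card_mfw_short_loop fin bx by (auto simp: k_def mfw1)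
      have "nat x \<le> F (card (mfw X A.loop))"
        proof (rule less.IH)
        show "nat x < n" "0 < nat x"
          using bx by auto
        show "range A.loop \<subseteq> X"
          by (rule A.loop_in)
        show "A.loop (i + int (nat x)) = A.loop i" for i
          using bx by (simp add: A.loop_def)
        show "int (nat x) dvd j" if "\<And>i. A.loop (i + j) = A.loop i" for j
        proof -
          have "x dvd j"
            using that by (rule A.loop_period)
          then show ?thesis
            using bx by simp
        qed
        show "finite (mfw X A.loop)"
          by (rule A(1))
      qed
      also have "\<dots> \<le> F (k - 2)"
        by (rule F_mono) (use A in simp)
      finally show ?thesis .
    qed
    moreover have "n = nat (int n - x) + nat x"
      using bx by linarith
    moreover have "F k = F (k - 1) + F (k - 2)"
      using F_rec[of "k - 1"] k by (simp add: numeral_2_eq_2)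
    ultimately show ?thesis
      using y by (simp add: k_def)
  qed
qed

section \<open>The exact period of \<open>biinf_power u\<close>\<close>

text \<open>By Bezout, \<open>gcd k (length u)\<close> is a period as well, so \<open>u\<close> is a
  power of its prefix of that length; as \<open>u\<close> is not periodic, the exponent is
  1.\<close>

lemma biinf_power_exact_period:
  assumes u: "u \<noteq> []" "\<not> periodic u" and k: "\<And>i. biinf_power u (i + k) = biinf_power u i"
  shows "int (length u) dvd k"
proof -
  let ?W = "biinf_power u" and ?n = "int (length u)"
  define g where "g = gcd k ?n"
  have g: "0 < g" "g dvd ?n" "g dvd k"
    using u by (auto simp: g_def)
  obtain a b where ab: "a * k + b * ?n = g"
    using bezout_int[of k ?n] by (auto simp: g_def)
  have per: "?W (i + g) = ?W i" for i
  proof -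
    have "?W (i + g) = ?W (i + a * k)"
      by (rule periodic_dvd[of ?W ?n]) (auto simp: biinf_power_def simp flip: ab)
    also have "\<dots> = ?W i"
      by (rule periodic_dvd[of ?W k]) (use k in auto)
    finally show ?thesis .
  qed
  define h where "h = nat g"
  have h: "int h = g" using g by (simp add: h_def)
  obtain r where r: "length u = r * h"
    using g(2) by (metis dvd_def h int_dvd_int_iff mult.commute)
  have "window ?W 0 (r' * h) = concat (replicate r' (window ?W 0 h))" for r'
  proof (induction r')
    case (Suc r')
    have "window ?W (int h) (r' * h) = window ?W 0 (r' * h)"
      using per[of "int _"] by (simp add: window_eq_iff h add.commute)
    then show ?case
      using Suc by (simp add: window_add)
  qed simp
  moreover have "window ?W 0 (length u) = u"
    by (auto simp: list_eq_iff_nth_eq biinf_power_def)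
  ultimately have "u = concat (replicate r (window ?W 0 h))"
    using r by metis
  then have "\<not> 2 \<le> r"
    using u unfolding periodic_def by blast
  moreover have "r \<noteq> 0"
    using r u(1) by (metis length_0_conv mult_0)
  ultimately have "length u = h"
    using r by (cases r) auto
  then show ?thesis
    using h g(3) by simp
qed

theorem theorem2p5:
  fixes X :: "'a set" and V :: "'a list set" and u :: "'a list"
  assumes "card X = 2"
    and "finite V"
    and "V \<subseteq> lists X"
    and "u \<in> lists X"
    and "u \<noteq> []"
    and "\<not> periodic u"
    and "defines_word X V (biinf_power u)"
  shows "length u \<le> F (card V)"
proof -
  have mfw: "finite (mfw X (biinf_power u))" "card (mfw X (biinf_power u)) \<le> card V"
    using card_mfw_le[OF assms(2,7)] by auto
  have "length u \<le> F (card (mfw X (biinf_power u)))"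
  proof (rule period_le_F_card_mfw)
    show "range (biinf_power u) \<subseteq> X"
      using assms(7) by (simp add: defines_word_def)
    show "biinf_power u (i + int (length u)) = biinf_power u i" for i
      by (simp add: biinf_power_def)
    show "int (length u) dvd k" if "\<And>i. biinf_power u (i + k) = biinf_power u i" for k
      using biinf_power_exact_period[OF assms(5,6)] that by blast
  qed (use assms mfw in auto)
  also have "\<dots> \<le> F (card V)"
    by (rule F_mono) (rule mfw(2))
  finally show ?thesis .
qed

end
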